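(* Let $\mathcal H$ be a real Hilbert space and let $f\in\Gamma_0(\mathcal H)$ be such that $\operatorname{lev}_{\leq 0}f\neq\varnothing$. Then the following are equivalent: (i) $G_f$ is monotone. (ii) For all $x,y\in\mathcal H$ with $f(x)>0$ and $f(y)>0$, all $u\in\partial f(x)$ and all $v\in\partial f(y)$, $$\Big\langle x-y,\ \frac{f(x)}{\|u\|^2}u-\frac{f(y)}{\|v\|^2}v\Big\rangle\leq\|x-y\|^2 .$$
   Context: $\Gamma_0(\mathcal H)$ is the set of proper convex lower semicontinuous functions $\mathcal H\to]-\infty,+\infty]$; $\operatorname{lev}_{\leq 0}f=\{x: f(x)\leq 0\}$. $\partial f$ is the convex subdifferential ($\partial f(x)=\varnothing$ if $f(x)=+\infty$). The subgradient projector $G_f:\mathcal H\to 2^{\mathcal H}$ is $G_fx=\{x\}$ if $f(x)\leq 0$ and $G_fx=\{x-\frac{f(x)}{\|u\|^2}u : u\in\partial f(x)\}$ if $f(x)>0$ (subgradients at points where $f>0$ are nonzero because $\operatorname{lev}_{\leq 0}f\neq\varnothing$). A set-valued operator $A:\mathcal H\to2^{\mathcal H}$ is monotone if $\langle x-y,p-q\rangle\geq 0$ whenever $p\in Ax$ and $q\in Ay$. *)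

theory Defs
  imports "HOL-Analysis.Analysis"
begin

definition proper_fun :: "('a \<Rightarrow> ereal) \<Rightarrow> bool" where
  "proper_fun f \<longleftrightarrow> (\<forall>x. f x \<noteq> - \<infinity>) \<and> (\<exists>x. f x \<noteq> \<infinity>)"

(* The library's convex_on is for real-valued functions only; an extended-real-valued
   function is convex iff its epigraph, a subset of H \<times> \<real>, is convex. *)
definition convex_fun :: "('a::real_vector \<Rightarrow> ereal) \<Rightarrow> bool" where
  "convex_fun f \<longleftrightarrow> convex {(x, r::real). f x \<le> ereal r}"

definition lsc_fun :: "('a::topological_space \<Rightarrow> ereal) \<Rightarrow> bool" where
  "lsc_fun f \<longleftrightarrow> (\<forall>x. f x \<le> Liminf (nhds x) f)"

definition Gamma0 :: "('a::real_normed_vector \<Rightarrow> ereal) set" where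
  "Gamma0 = {f. proper_fun f \<and> convex_fun f \<and> lsc_fun f}"

definition lev_le0 :: "('a \<Rightarrow> ereal) \<Rightarrow> 'a set" where
  "lev_le0 f = {x. f x \<le> 0}"

definition subdifferential :: "('a::real_inner \<Rightarrow> ereal) \<Rightarrow> 'a \<Rightarrow> 'a set" where
  "subdifferential f x =
     (if f x = \<infinity> then {} else {u. \<forall>y. ereal ((y - x) \<bullet> u) + f x \<le> f y})"

(* Where a proper f has a subgradient its value is finite, so real_of_ereal loses nothing;
   if f x = \<infinity> the set below is empty. *)
definition subgrad_projector :: "('a::real_inner \<Rightarrow> ereal) \<Rightarrow> 'a \<Rightarrow> 'a set" where
  "subgrad_projector f x =
     (if f x \<le> 0 then {x}
      else {x - (real_of_ereal (f x) / (norm u)\<^sup>2) *\<^sub>R u | u. u \<in> subdifferential f x})"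

definition monotone_operator :: "('a::real_inner \<Rightarrow> 'a set) \<Rightarrow> bool" where
  "monotone_operator A \<longleftrightarrow>
     (\<forall>x y. \<forall>p\<in>A x. \<forall>q\<in>A y. (x - y) \<bullet> (p - q) \<ge> 0)"

end

(* The displacement x - p of a point p of G_f x is (f x / |u|^2) u, so monotonicity at two points
   where f > 0 is condition (ii) verbatim. If only f x > 0 while f y \<le> 0, then
   t = <x - y, u> satisfies t \<ge> f x by the subgradient inequality at y, and Cauchy-Schwarz yields
   f x * t \<le> t^2 \<le> |x - y|^2 |u|^2; hence such mixed pairs impose no further condition. *)
theory Submission
  imports Defs
begin

text \<open>Geometrically, subtracting the scaled \<open>u\<close> from \<open>x\<close> projects
  \<open>x\<close> onto the half-space of all z with f(x) + <z - x, u> \<le> 0. By the subgradient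
  inequality this half-space contains \<open>y\<close>, so the displacement has length at most |x -
  y|.\<close>

lemma subgradient_displacement_le:
  fixes f :: "'a::real_inner \<Rightarrow> ereal"
  assumes pos: "f x > 0" and y: "f y \<le> 0" and u: "u \<in> subdifferential f x"
  shows "(x - y) \<bullet> ((real_of_ereal (f x) / (norm u)\<^sup>2) *\<^sub>R u) \<le> (norm (x - y))\<^sup>2"
proof -
  from u have fin: "f x \<noteq> \<infinity>" and sub: "ereal ((y - x) \<bullet> u) + f x \<le> f y"
    by (auto simp: subdifferential_def split: if_splits)
  obtain r where r: "f x = ereal r"
    using fin pos by (cases "f x") auto
  have r0: "r > 0" using pos r by simp
  have "ereal ((y - x) \<bullet> u + r) \<le> 0" using order_trans[OF sub y] r by simp
  then have t: "r \<le> (x - y) \<bullet> u" by (simp add: inner_diff_left)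
  \<comment> \<open>A zero \<open>u\<close> would force \<open>r\<close> \<le> 0; hence the quotient
    by the squared norm of \<open>u\<close> is a genuine division.\<close>
  then have u0: "u \<noteq> 0" using r0 by auto
  \<comment> \<open>The bound \<open>t\<close> is multiplied by the inner product, which is itself
    positive because it is at least \<open>r\<close>.\<close>
  have "r * ((x - y) \<bullet> u) \<le> ((x - y) \<bullet> u)\<^sup>2"
    using t r0 by (simp add: power2_eq_square mult_right_mono)
  also have "\<dots> \<le> (norm (x - y))\<^sup>2 * (norm u)\<^sup>2"
    using Cauchy_Schwarz_ineq[of "x - y" u] by (simp add: power2_norm_eq_inner)
  finally show ?thesis
    using u0 r by (simp add: divide_simps)
qed

theorem mainTheorem20:
  fixes f :: "'a::{real_inner, complete_space} \<Rightarrow> ereal"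
  assumes "f \<in> Gamma0"
    and "lev_le0 f \<noteq> {}"
  shows "monotone_operator (subgrad_projector f) \<longleftrightarrow>
    (\<forall>x y. f x > 0 \<and> f y > 0 \<longrightarrow>
      (\<forall>u\<in>subdifferential f x. \<forall>v\<in>subdifferential f y.
        (x - y) \<bullet> ((real_of_ereal (f x) / (norm u)\<^sup>2) *\<^sub>R u
                   - (real_of_ereal (f y) / (norm v)\<^sup>2) *\<^sub>R v) \<le> (norm (x - y))\<^sup>2))"
    (is "?M \<longleftrightarrow> ?C")
proof -
  define d where "d x u = (real_of_ereal (f x) / (norm u)\<^sup>2) *\<^sub>R u" for x u :: 'a
  have G_pos: "subgrad_projector f x = {x - d x u | u. u \<in> subdifferential f x}" if "f x > 0" for x
    using that by (auto simp: subgrad_projector_def d_def)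
  have G_nonpos: "subgrad_projector f x = {x}" if "f x \<le> 0" for x
    using that by (simp add: subgrad_projector_def)
  \<comment> \<open>Turns monotonicity for a pair of points into an upper bound on displacements.
    Taking \<open>a\<close> or \<open>b\<close> to be 0 covers a point that the projector
    fixes.\<close>
  have expand: "(x - y) \<bullet> ((x - a) - (y - b)) = (norm (x - y))\<^sup>2 - (x - y) \<bullet> (a - b)"
    for x y a b :: 'a
    by (simp add: power2_norm_eq_inner inner_diff_left inner_diff_right)
  have mixed: "(x - y) \<bullet> d x u \<le> (norm (x - y))\<^sup>2"
    if "f x > 0" "f y \<le> 0" "u \<in> subdifferential f x" for x y u
    using subgradient_displacement_le[OF that] by (simp add: d_def)
  have "?M \<longleftrightarrow> (\<forall>x y. f x > 0 \<and> f y > 0 \<longrightarrow>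
      (\<forall>u\<in>subdifferential f x. \<forall>v\<in>subdifferential f y.
        (x - y) \<bullet> (d x u - d y v) \<le> (norm (x - y))\<^sup>2))" (is "_ \<longleftrightarrow> ?D")
  proof
    assume M: ?M
    show ?D
    proof (intro allI impI ballI)
      fix x y u v
      assume "f x > 0 \<and> f y > 0" and "u \<in> subdifferential f x" "v \<in> subdifferential f y"
      then have "x - d x u \<in> subgrad_projector f x" "y - d y v \<in> subgrad_projector f y"
        by (auto simp: G_pos)
      then have "0 \<le> (x - y) \<bullet> ((x - d x u) - (y - d y v))"
        using M unfolding monotone_operator_def by blast
      then show "(x - y) \<bullet> (d x u - d y v) \<le> (norm (x - y))\<^sup>2"
        unfolding expand by simp
    qed
  next
    assume D: ?D
    show ?M
      unfolding monotone_operator_def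
    proof (intro allI ballI)
      fix x y p q
      assume p: "p \<in> subgrad_projector f x" and q: "q \<in> subgrad_projector f y"
      consider "f x \<le> 0" "f y \<le> 0" | "f x > 0" "f y \<le> 0" | "f x \<le> 0" "f y > 0" | "f x > 0" "f y > 0"
        by fastforce
      then show "0 \<le> (x - y) \<bullet> (p - q)"
      proof cases
        case 1
        then show ?thesis using p q by (simp add: G_nonpos)
      next
        case 2
        then obtain u where "u \<in> subdifferential f x" "p = x - d x u" "q = y"
          using p q by (auto simp: G_pos G_nonpos)
        then show ?thesis
          using mixed[of x y u] 2 expand[of x y "d x u" 0] by simp
      next
        case 3
        then obtain v where "v \<in> subdifferential f y" "q = y - d y v" "p = x"
          using p q by (auto simp: G_pos G_nonpos)
        \<comment> \<open>Mirror image of the previous case: the two sign changes in (y - x) and in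
          0 - \<open>d y v\<close> cancel, so \<open>mixed\<close> applies with the points
          exchanged.\<close>
        then show ?thesis
          using mixed[of y x v] 3 expand[of x y 0 "d y v"]
          by (simp add: norm_minus_commute inner_diff_left)
      next
        case 4
        then obtain u v where "u \<in> subdifferential f x" "p = x - d x u"
            "v \<in> subdifferential f y" "q = y - d y v"
          using p q by (auto simp: G_pos)
        then show ?thesis
          using D 4 by (simp add: expand)
      qed
    qed
  qed
  then show ?thesis by (simp add: d_def)
qed

end
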